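(* Let $d,r\in\mathbb{N}$, $h>0$, $\sigma\ge 0$, and consider the velocity estimator $v_{h,j}^n=\sum_{k=-r}^r w_k\,y^n_{j+k}$ with real weights $w_{-r},\dots,w_r$ satisfying the consistency conditions $\sum_{k=-r}^r w_k=0$ and $\sum_{k=-r}^r w_k\,kh=1$. Let $\Sigma=\{x\in\mathbb{R}^d: s(x)=0\}$ with $s(x)=a^\top x+b$, $a\in\mathbb{R}^d\setminus\{0\}$, $b\in\mathbb{R}$, and let $f^+$ (governing the dynamics where $s>0$) and $f^-$ (governing the dynamics where $s<0$) be smooth and extendable to the whole domain. Assume that a reference trajectory $x_*^n$ of the piecewise-smooth system $\dot x=f^{\pm}(x,t)$ for $\pm s(x)>0$ crosses $\Sigma$ transversally at one single time $\tau$, with $s(x_*^n(t))<0$ before the crossing. Set $p=x_*^n(\tau)\in\Sigma$. Let $x^+$ be the solution of $\dot x=f^+(x,t)$ with $x^+(\tau)=p$, and let $x^-$ be the trajectory of $f^-$ agreeing with $x_*^n$ before the switch, so that by continuity $x^-(\tau)=x^+(\tau)=p$. Write $$f^+(p,\tau)-f^-(p,\tau)=\kappa e,\qquad \kappa=\|f^+(p,\tau)-f^-(p,\tau)\|_2>0,\quad e\in\mathbb{R}^d,\ \|e\|_2=1.$$ Assume that the second time derivatives of both $x^+$ and $x^-$ are uniformly bounded by $M$ (in Euclidean norm). With $t_{j+k}=t_j+kh$ and $c=(c_k)_{k=-r}^{r+1}$ given by $c_{-r}=-w_{-r}$, $c_{r+1}=w_r$, $c_k=w_{k-1}-w_k$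 for $-r<k\le r$, let $$R=\sum_{k=-r}^{r+1}c_k\max(t_{j+k}-\tau,0),\qquad \alpha=M\sum_{k:\,t_{j+k}>\tau}|c_k|(t_{j+k}-\tau)^2,\qquad \beta=\frac M2\sum_{k=-r}^{r+1}|c_k|(t_{j+k}-t_j)^2.$$ Consider two scenarios for the estimated velocity jump $\Delta v^n_{h,j}=v^n_{h,j+1}-v^n_{h,j}=\sum_{k=-r}^{r+1}c_k\,y^n_{j+k}$. In the first, the trajectory jumps within the stencil used to compute $\Delta v^n_{h,j}$ (the noise-free trajectory equals $x^-$ up to time $\tau$ and $x^+$ after $\tau$); in the second, the noise-free trajectory follows $x^-$ throughout the stencil. Denote the resulting jump estimates by $\Delta_1$ and $\Delta_2$, respectively. Then: 1. Both $\Delta_1$ and $\Delta_2$ are Gaussian, $\Delta_i\sim\mathsf{N}(\mu_i,C)$, with $C=\sigma^2\|c\|_2^2 I_d$ and $\mu_1-\mu_2=\kappa R e+\varrho$, where $\varrho\in\mathbb{R}^d$ satisfies $\|\varrho\|_2\le\alpha$. 2. The expected magnitudes satisfy $$\mathbb{E}[\|\Delta_1\|_2]\ge \kappa|R|-\beta-\alpha,\qquad \mathbb{E}[\|\Delta_2\|_2]\le\beta+\sigma\|c\|_2\sqrt d,$$ so that $\mathbb{E}[\|\Delta_1\|_2]>\mathbb{E}[\|\Delta_2\|_2]$ whenever $\kappa|R|>2\beta+\alpha+\sigma\|c\|_2\sqrt d$.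
   Context: Data model: for trajectory $n$, the sampling times are $t_j=t_j^n=t_0^n+jh$, $j=0,\dots,J$, known exactly, and the observations are $y_j^n=x(t_j)+\eta_j^n$, where $x$ is the noise-free trajectory under consideration and the $\eta_j^n\sim\mathsf{N}(0,\sigma^2 I_d)$ are independent across $n$ and $j$; $I_d$ is the $d\times d$ identity. The index $j$ is such that all stencil indices $j-r,\dots,j+r+1$ lie in $\{0,\dots,J\}$, and $x^+$, $x^-$ are defined on the time window spanned by the stencil. $\|\cdot\|_2$ is the Euclidean norm, and $\mathsf{N}(\mu,C)$ is the Gaussian distribution with mean $\mu$ and covariance $C$ (degenerate if $C=0$). A transversal crossing of $\Sigma$ at $(p,\tau)$ means that the normal components $a^\top f^+(p,\tau)$ and $a^\top f^-(p,\tau)$ are nonzero and have the same sign. *)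

theory Defs
  imports "HOL-Probability.Probability"
begin

text \<open>
  \<open>C\<^sup>k\<close> is expressed through iterated directional derivatives, so that the type of the
  function does not change in the recursion.
\<close>

fun Ck :: "nat \<Rightarrow> ('a::euclidean_space \<Rightarrow> 'b::real_normed_vector) \<Rightarrow> bool" where
  "Ck 0 f \<longleftrightarrow> continuous_on UNIV f"
| "Ck (Suc k) f \<longleftrightarrow>
     (\<forall>x. f differentiable (at x)) \<and> (\<forall>v. Ck k (\<lambda>x. frechet_derivative f (at x) v))"

definition smooth :: "('a::euclidean_space \<Rightarrow> 'b::real_normed_vector) \<Rightarrow> bool" where
  "smooth f \<longleftrightarrow> (\<forall>k. Ck k f)"

definition solution_on ::
  "('a::real_normed_vector \<Rightarrow> real \<Rightarrow> 'a) \<Rightarrow> real set \<Rightarrow> (real \<Rightarrow> 'a) \<Rightarrow> bool" where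
  "solution_on f I x \<longleftrightarrow> (\<forall>t\<in>I. (x has_vector_derivative f (x t) t) (at t within I))"

text \<open>No differentiability is required at times at which the trajectory lies on \<open>s = 0\<close>.\<close>

definition piecewise_solution_on ::
  "('a::real_normed_vector \<Rightarrow> real) \<Rightarrow> ('a \<Rightarrow> real \<Rightarrow> 'a) \<Rightarrow> ('a \<Rightarrow> real \<Rightarrow> 'a) \<Rightarrow>
   real set \<Rightarrow> (real \<Rightarrow> 'a) \<Rightarrow> bool" where
  "piecewise_solution_on s fp fm I x \<longleftrightarrow>
     continuous_on I x \<and>
     (\<forall>t\<in>I. s (x t) > 0 \<longrightarrow> (x has_vector_derivative fp (x t) t) (at t within I)) \<and>
     (\<forall>t\<in>I. s (x t) < 0 \<longrightarrow> (x has_vector_derivative fm (x t) t) (at t within I))"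

definition transversal ::
  "'a::real_inner \<Rightarrow> ('a \<Rightarrow> real \<Rightarrow> 'a) \<Rightarrow> ('a \<Rightarrow> real \<Rightarrow> 'a) \<Rightarrow> 'a \<Rightarrow> real \<Rightarrow> bool" where
  "transversal a fp fm p \<tau> \<longleftrightarrow>
     a \<bullet> fp p \<tau> \<noteq> 0 \<and> a \<bullet> fm p \<tau> \<noteq> 0 \<and> sgn (a \<bullet> fp p \<tau>) = sgn (a \<bullet> fm p \<tau>)"

definition normal_measure :: "real \<Rightarrow> real \<Rightarrow> real measure" where
  "normal_measure m v =
     (if v = 0 then return borel m else density lborel (normal_density m (sqrt v)))"

text \<open>
  \<open>gaussian P X \<mu> C\<close> means \<open>X \<sim> N(\<mu>, C)\<close>, where \<open>C\<close> may be singular: every linear functional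
  \<open>u \<bullet> X\<close> has the one-dimensional law \<open>N(u \<bullet> \<mu>, u \<bullet> C u)\<close>, with \<open>N(m, 0)\<close> the point mass at
  \<open>m\<close>. By Cramer--Wold this determines the law of \<open>X\<close>.
\<close>

definition gaussian ::
  "'w measure \<Rightarrow> ('w \<Rightarrow> real ^ 'd) \<Rightarrow> real ^ 'd \<Rightarrow> real ^ 'd ^ 'd \<Rightarrow> bool" where
  "gaussian P X \<mu> C \<longleftrightarrow>
     X \<in> borel_measurable P \<and> transpose C = C \<and> (\<forall>u. u \<bullet> (C *v u) \<ge> 0) \<and>
     (\<forall>u. distr P borel (\<lambda>\<omega>. u \<bullet> X \<omega>) = normal_measure (u \<bullet> \<mu>) (u \<bullet> (C *v u)))"

definition velocity_est ::
  "(int \<Rightarrow> real) \<Rightarrow> nat \<Rightarrow> (int \<Rightarrow> 'a::real_vector) \<Rightarrow> int \<Rightarrow> 'a" where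
  "velocity_est w r y j = (\<Sum>k\<in>{- int r..int r}. w k *\<^sub>R y (j + k))"

definition jump_est ::
  "(int \<Rightarrow> real) \<Rightarrow> nat \<Rightarrow> (int \<Rightarrow> 'a::real_vector) \<Rightarrow> int \<Rightarrow> 'a" where
  "jump_est w r y j = velocity_est w r y (j + 1) - velocity_est w r y j"

definition jump_coeff :: "(int \<Rightarrow> real) \<Rightarrow> nat \<Rightarrow> int \<Rightarrow> real" where
  "jump_coeff w r k =
     (if k = - int r then - w (- int r)
      else if k = int r + 1 then w (int r)
      else w (k - 1) - w k)"

lemma jump_est_eq_sum:
  "jump_est w r y j = (\<Sum>k\<in>{- int r..int r + 1}. jump_coeff w r k *\<^sub>R y (j + k))"
proof -
  let ?u = "\<lambda>k. (if k = - int r then 0 else w (k - 1)) *\<^sub>R y (j + k)"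
  let ?v = "\<lambda>k. (if k = int r + 1 then 0 else w k) *\<^sub>R y (j + k)"
  have "(\<Sum>k\<in>{- int r..int r}. w k *\<^sub>R y (j + 1 + k))
      = (\<Sum>k\<in>{- int r + 1..int r + 1}. w (k - 1) *\<^sub>R y (j + k))"
    by (rule sum.reindex_bij_witness[where i = "\<lambda>k. k - 1" and j = "\<lambda>k. k + 1"])
       (auto simp: algebra_simps)
  also have "\<dots> = (\<Sum>k\<in>{- int r..int r + 1}. ?u k)"
    by (rule sum.mono_neutral_cong_left) auto
  finally have 1: "velocity_est w r y (j + 1) = (\<Sum>k\<in>{- int r..int r + 1}. ?u k)"
    by (simp add: velocity_est_def)
  have 2: "velocity_est w r y j = (\<Sum>k\<in>{- int r..int r + 1}. ?v k)"
    unfolding velocity_est_def by (rule sum.mono_neutral_cong_left) auto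
  show ?thesis
    unfolding jump_est_def 1 2 sum_subtractf[symmetric]
    by (rule sum.cong) (auto simp: jump_coeff_def scaleR_diff_left)
qed

text \<open>
  \<open>\<eta> i l\<close> is the noise in sample \<open>l \<in> {0..J}\<close> of trajectory \<open>i \<in> T\<close>. Sample indices are integers
  because the stencil offsets are.
\<close>

definition noise_model ::
  "'w measure \<Rightarrow> 'i set \<Rightarrow> nat \<Rightarrow> real \<Rightarrow> ('i \<Rightarrow> int \<Rightarrow> 'w \<Rightarrow> real ^ 'd) \<Rightarrow> bool" where
  "noise_model P T J \<sigma> \<eta> \<longleftrightarrow>
     prob_space P \<and>
     (\<forall>i\<in>T. \<forall>l\<in>{0..int J}. gaussian P (\<eta> i l) 0 (\<sigma>\<^sup>2 *\<^sub>R mat 1)) \<and>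
     prob_space.indep_vars P (\<lambda>_. borel) (\<lambda>(i, l). \<eta> i l) (T \<times> {0..int J})"

definition sample_time :: "real \<Rightarrow> real \<Rightarrow> int \<Rightarrow> real" where
  "sample_time t0 h l = t0 + of_int l * h"

definition observation ::
  "(real \<Rightarrow> 'a::real_vector) \<Rightarrow> (int \<Rightarrow> real) \<Rightarrow> (int \<Rightarrow> 'w \<Rightarrow> 'a) \<Rightarrow> 'w \<Rightarrow> int \<Rightarrow> 'a" where
  "observation x t \<eta> \<omega> l = x (t l) + \<eta> l \<omega>"

end

theory Submission
  imports Defs
begin

text \<open>
  The two estimates share the noise \<open>Z = \<Sum>k. c k \<eta> (j + k)\<close>, so they differ only in their means.
  Taylor expansion of \<open>xp - xm\<close> about \<open>\<tau>\<close>, where it vanishes and has velocity \<open>\<kappa> e\<close>, gives the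
  difference of the means. Taylor expansion of \<open>xm\<close> about \<open>t j\<close> bounds the second mean, because the
  consistency conditions make \<open>c\<close> annihilate affine functions. For the magnitudes, Jensen's inequality
  yields \<open>\<parallel>\<mu>\<parallel> \<le> E \<parallel>\<mu> + Z\<parallel> \<le> \<parallel>\<mu>\<parallel> + sqrt (E \<parallel>Z\<parallel>\<^sup>2)\<close>, and \<open>E \<parallel>Z\<parallel>\<^sup>2\<close> is the trace of the covariance.
\<close>

section \<open>Second order Taylor bounds\<close>

text \<open>The mean value inequality is applied twice: first to \<open>x'\<close>, which becomes
  \<open>K\<close>-Lipschitz, then to \<open>x\<close> minus its linear part at \<open>u\<close>.
  This suits vector values, for which no single intermediate point gives the remainder. The base
  point may lie on either side of \<open>v\<close>, because the stencil extends to both sides of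
  \<open>t j\<close>.\<close>

lemma norm_taylor2_le:
  fixes x x' x'' :: "real \<Rightarrow> 'a::real_normed_vector"
  assumes x: "\<And>u. u \<in> {a..b} \<Longrightarrow> (x has_vector_derivative x' u) (at u within {a..b})"
    and x': "\<And>u. u \<in> {a..b} \<Longrightarrow> (x' has_vector_derivative x'' u) (at u within {a..b})"
    and bound: "\<And>u. u \<in> {a..b} \<Longrightarrow> norm (x'' u) \<le> K"
    and u: "u \<in> {a..b}" and v: "v \<in> {a..b}"
  shows "norm (x v - x u - (v - u) *\<^sub>R x' u) \<le> K / 2 * (v - u)\<^sup>2"
proof -
  have interior: "at s within {a..b} = at s" if "a < s" "s < b" for s
    using that by (intro at_within_interior) simp
  have x_at: "(x has_vector_derivative x' s) (at s)" if "a < s" "s < b" for s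
    using x[of s] that interior[of s] by simp
  have x'_at: "(x' has_vector_derivative x'' s) (at s)" if "a < s" "s < b" for s
    using x'[of s] that interior[of s] by simp
  have cont: "continuous_on {a..b} x" "continuous_on {a..b} x'"
    unfolding continuous_on_eq_continuous_within
    by (blast intro: has_vector_derivative_continuous x x')+
  have lip: "norm (x' q - x' p) \<le> K * q - K * p" if "p \<in> {a..b}" "q \<in> {a..b}" "p < q" for p q
  proof (rule differentiable_bound_general[OF \<open>p < q\<close>, where f' = x'' and \<phi>' = "\<lambda>_. K"])
    show "continuous_on {p..q} x'"
      using that by (intro continuous_on_subset[OF cont(2)]) auto
    show "continuous_on {p..q} ((*) K)" by (intro continuous_intros)
    show "(x' has_vector_derivative x'' s) (at s)" if "p < s" "s < q" for s
      using that \<open>p \<in> _\<close> \<open>q \<in> _\<close> by (intro x'_at) auto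
    show "((*) K has_vector_derivative K) (at s)" for s
      by (auto intro!: derivative_eq_intros simp flip: has_real_derivative_iff_has_vector_derivative)
    show "norm (x'' s) \<le> K" if "p < s" "s < q" for s
      using that \<open>p \<in> _\<close> \<open>q \<in> _\<close> by (intro bound) auto
  qed
  \<comment> \<open>Removing the linear part at \<open>u\<close> leaves the derivative
    \<open>x' s - x' u\<close>, whose norm the Lipschitz bound controls by \<open>K\<close> times
    the distance from \<open>s\<close> to \<open>u\<close>.\<close>
  define g where "g s = x s - (s - u) *\<^sub>R x' u" for s
  have g_cont: "continuous_on S g" if "S \<subseteq> {a..b}" for S
    unfolding g_def using continuous_on_subset[OF cont(1) that] by (intro continuous_intros) auto
  have g_at: "(g has_vector_derivative x' s - x' u) (at s)" if "a < s" "s < b" for s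
    unfolding g_def using x_at[OF that]
    by (auto intro!: derivative_eq_intros simp: has_vector_derivative_def algebra_simps)
  have phi_at: "((\<lambda>s. c * (s - u)\<^sup>2) has_vector_derivative 2 * c * (s - u)) (at s)" for c s :: real
    by (auto intro!: derivative_eq_intros simp flip: has_real_derivative_iff_has_vector_derivative)
  consider "v = u" | "u < v" | "v < u" by linarith
  then show ?thesis
  proof cases
    case 2
    have "norm (g v - g u) \<le> K / 2 * (v - u)\<^sup>2 - K / 2 * (u - u)\<^sup>2"
    proof (rule differentiable_bound_general[OF 2, where f' = "\<lambda>s. x' s - x' u"
            and \<phi>' = "\<lambda>s. 2 * (K / 2) * (s - u)" and \<phi> = "\<lambda>s. K / 2 * (s - u)\<^sup>2"])
      show "continuous_on {u..v} g" using u v by (intro g_cont) auto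
      show "norm (x' s - x' u) \<le> 2 * (K / 2) * (s - u)" if "u < s" "s < v" for s
        using lip[of u s] that u v by (auto simp: algebra_simps)
      show "continuous_on {u..v} (\<lambda>s. K / 2 * (s - u)\<^sup>2)" by (intro continuous_intros)
      show "(g has_vector_derivative x' s - x' u) (at s)" if "u < s" "s < v" for s
        using that u v by (intro g_at) auto
    qed (rule phi_at)
    then show ?thesis by (simp add: g_def algebra_simps)
  next
    case 3
    \<comment> \<open>To the left of \<open>u\<close> the majorant must still increase with
      \<open>s\<close>. The sign is therefore reversed, which gives it the derivative
      \<open>K * (u - s)\<close>.\<close>
    have "norm (g u - g v) \<le> - K / 2 * (u - u)\<^sup>2 - (- K / 2 * (v - u)\<^sup>2)"
    proof (rule differentiable_bound_general[OF 3, where f' = "\<lambda>s. x' s - x' u"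
            and \<phi>' = "\<lambda>s. 2 * (- K / 2) * (s - u)" and \<phi> = "\<lambda>s. - K / 2 * (s - u)\<^sup>2"])
      show "continuous_on {v..u} g" using u v by (intro g_cont) auto
      show "norm (x' s - x' u) \<le> 2 * (- K / 2) * (s - u)" if "v < s" "s < u" for s
        using lip[of s u] that u v by (auto simp: algebra_simps norm_minus_commute)
      show "continuous_on {v..u} (\<lambda>s. - K / 2 * (s - u)\<^sup>2)" by (intro continuous_intros)
      show "(g has_vector_derivative x' s - x' u) (at s)" if "v < s" "s < u" for s
        using that u v by (intro g_at) auto
    qed (rule phi_at)
    then show ?thesis by (simp add: g_def algebra_simps norm_minus_commute)
  qed simp
qed

lemma smooth_imp_differentiable: "smooth f \<Longrightarrow> f differentiable (at x)"
  using Ck.simps(2)[of 0 f] by (auto simp: smooth_def simp del: Ck.simps)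

text \<open>The operator \<open>vector_derivative\<close> returns an unspecified value where no
  derivative exists, so a bound on the iterated operator says nothing until differentiability is
  known. The chain rule supplies it, since \<open>f\<close> is smooth and the curve of pairs
  \<open>(x v, v)\<close> is differentiable. The condition \<open>a < b\<close> makes derivatives
  within the interval unique, also at its endpoints.\<close>

lemma solution_on_derivative_differentiable:
  fixes x :: "real \<Rightarrow> 'a::euclidean_space"
  assumes f: "smooth (\<lambda>(y, u). f y u)" and x: "solution_on f {a..b} x"
    and "a < b" and u: "u \<in> {a..b}"
  shows "((\<lambda>v. f (x v) v) has_vector_derivative
    vector_derivative (\<lambda>v. vector_derivative x (at v within {a..b})) (at u within {a..b}))
    (at u within {a..b})"
proof -
  let ?x' = "\<lambda>v. vector_derivative x (at v within {a..b})"
  have x': "(x has_vector_derivative f (x v) v) (at v within {a..b})" if "v \<in> {a..b}" for v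
    using x that by (auto simp: solution_on_def)
  have eq: "?x' v = f (x v) v" if "v \<in> {a..b}" for v
    using vector_derivative_within_closed_interval[OF \<open>a < b\<close> that x'[OF that]] .
  have "(\<lambda>v. (x v, v)) differentiable (at u within {a..b})"
    using x'[OF u] by (auto intro!: differentiable_Pair simp: differentiableI_vector)
  then have "((\<lambda>(y, u). f y u) \<circ> (\<lambda>v. (x v, v))) differentiable (at u within {a..b})"
    using smooth_imp_differentiable[OF f]
    by (intro differentiable_chain_within) (auto intro: differentiable_at_withinI)
  then obtain D where D: "((\<lambda>v. f (x v) v) has_vector_derivative D) (at u within {a..b})"
    by (auto simp: o_def vector_derivative_works)
  then have "(?x' has_vector_derivative D) (at u within {a..b})"
    by (rule has_vector_derivative_transform[OF u, rotated]) (rule eq)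
  with D vector_derivative_within_closed_interval[OF \<open>a < b\<close> u this] show ?thesis by simp
qed

section \<open>One-dimensional normal laws\<close>

context prob_space
begin

text \<open>A point mass is the law of an almost surely constant variable; this reduces the
  degenerate cases below to almost sure equalities.\<close>

lemma distr_eq_normal_measure_0_iff:
  assumes "X \<in> borel_measurable M"
  shows "distr M borel X = normal_measure m 0 \<longleftrightarrow> (AE \<omega> in M. X \<omega> = m)"
proof
  assume "distr M borel X = normal_measure m 0"
  then have *: "distr M borel X = return borel m" by (simp add: normal_measure_def)
  have "AE y in distr M borel X. y = m" unfolding * by (subst AE_return) auto
  then show "AE \<omega> in M. X \<omega> = m" using assms by (subst (asm) AE_distr_iff) auto
next
  assume "AE \<omega> in M. X \<omega> = m"
  then have "distr M borel X = distr M borel (\<lambda>_. m)"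
    using assms by (intro distr_cong_AE) auto
  then show "distr M borel X = normal_measure m 0" by (simp add: normal_measure_def)
qed

text \<open>Connects \<open>normal_measure\<close> to the library notion \<open>distributed\<close>,
  which takes its density with respect to \<open>lborel\<close>. The two push-forwards agree because
  \<open>borel\<close> and \<open>lborel\<close> have the same measurable sets.\<close>

lemma distr_eq_normal_measure_iff:
  assumes "X \<in> borel_measurable M" "v \<noteq> 0"
  shows "distr M borel X = normal_measure m v \<longleftrightarrow>
    distributed M lborel X (normal_density m (sqrt v))"
proof -
  have "distr M lborel X = distr M borel X" by (rule distr_cong) auto
  then show ?thesis using assms by (auto simp: distributed_def normal_measure_def)
qed

lemma distr_normal_affine:
  assumes X: "X \<in> borel_measurable M" and law: "distr M borel X = normal_measure m v" and "v \<ge> 0"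
  shows "distr M borel (\<lambda>\<omega>. q + c * X \<omega>) = normal_measure (q + c * m) (c\<^sup>2 * v)"
\<comment> \<open>Either equation makes the image variable almost surely constant; otherwise the
  density of a nondegenerate normal law can be transformed.\<close>
proof (cases "c = 0 \<or> v = 0")
  case True
  have "AE \<omega> in M. c * X \<omega> = c * m"
  proof (cases "c = 0")
    case False
    with True law have "AE \<omega> in M. X \<omega> = m"
      by (simp flip: distr_eq_normal_measure_0_iff[OF X])
    then show ?thesis by eventually_elim simp
  qed simp
  then have "distr M borel (\<lambda>\<omega>. q + c * X \<omega>) = normal_measure (q + c * m) 0"
    using X by (subst distr_eq_normal_measure_0_iff) auto
  moreover have "c\<^sup>2 * v = 0" using True by auto
  ultimately show ?thesis by (simp only:)
next
  case False
  then have "v > 0" using \<open>v \<ge> 0\<close> by simp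
  have "distributed M lborel (\<lambda>\<omega>. q + c * X \<omega>) (normal_density (q + c * m) (\<bar>c\<bar> * sqrt v))"
    using False \<open>v > 0\<close> law X
    by (intro normal_density_affine) (auto simp: distr_eq_normal_measure_iff)
  then show ?thesis
    using False X by (subst distr_eq_normal_measure_iff) (auto simp: real_sqrt_mult)
qed

lemma distr_sum_indep_normal:
  assumes "finite K" and indep: "indep_vars (\<lambda>_. borel) X K"
    and law: "\<And>k. k \<in> K \<Longrightarrow> distr M borel (X k) = normal_measure (m k) (v k)"
    and v: "\<And>k. k \<in> K \<Longrightarrow> v k \<ge> 0"
  shows "distr M borel (\<lambda>\<omega>. \<Sum>k\<in>K. X k \<omega>) = normal_measure (\<Sum>k\<in>K. m k) (\<Sum>k\<in>K. v k)"
proof -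
  have X: "X k \<in> borel_measurable M" if "k \<in> K" for k
    using indep that by (auto simp: indep_vars_def)
  \<comment> \<open>The library only sums nondegenerate normal variables; the others are almost surely constant.\<close>
  define L where "L = {k \<in> K. v k \<noteq> 0}"
  have L: "finite L" "L \<subseteq> K" using \<open>finite K\<close> by (auto simp: L_def)
  have split: "sum f K = sum f (K - L) + sum f L" for f :: "_ \<Rightarrow> real"
    using \<open>finite K\<close> L by (simp add: sum.subset_diff)
  have sum_v: "sum v K = sum v L" unfolding split[of v] by (simp add: L_def)
  have "AE \<omega> in M. \<forall>k\<in>K - L. X k \<omega> = m k"
  proof (rule AE_finite_allI)
    show "AE \<omega> in M. X k \<omega> = m k" if "k \<in> K - L" for k
      using that law[of k] distr_eq_normal_measure_0_iff[OF X[of k]] by (auto simp: L_def)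
  qed (use \<open>finite K\<close> in auto)
  \<comment> \<open>The factor \<open>1\<close> gives the right-hand side the affine shape of
    \<open>distr_normal_affine\<close>, with the degenerate variables absorbed into the
    shift.\<close>
  then have ae: "AE \<omega> in M. (\<Sum>k\<in>K. X k \<omega>) = sum m (K - L) + 1 * (\<Sum>k\<in>L. X k \<omega>)"
    by eventually_elim (auto simp: split intro!: sum.cong)
  have "distr M borel (\<lambda>\<omega>. \<Sum>k\<in>L. X k \<omega>) = normal_measure (sum m L) (sum v L)"
  proof (cases "L = {}")
    case True
    then show ?thesis by (simp add: normal_measure_def)
  next
    case False
    have pos: "v k > 0" if "k \<in> L" for k using that v[of k] by (auto simp: L_def)
    then have "sum v L > 0" using False L by (intro sum_pos) auto
    moreover have "distributed M lborel (\<lambda>\<omega>. \<Sum>k\<in>L. X k \<omega>)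
        (normal_density (sum m L) (sqrt (\<Sum>k\<in>L. (sqrt (v k))\<^sup>2)))"
    proof (rule sum_indep_normal[OF L(1) False indep_vars_subset[OF indep L(2)]])
      show "distributed M lborel (X k) (normal_density (m k) (sqrt (v k)))" if "k \<in> L" for k
        using that pos[OF that] L X[of k] law[of k]
        by (subst distr_eq_normal_measure_iff[symmetric]) auto
    qed (use pos in auto)
    moreover have "(\<Sum>k\<in>L. (sqrt (v k))\<^sup>2) = sum v L"
      using pos by (intro sum.cong) (auto simp: less_imp_le)
    ultimately show ?thesis
      using X L by (subst distr_eq_normal_measure_iff) (auto intro!: borel_measurable_sum)
  qed
  then have "distr M borel (\<lambda>\<omega>. sum m (K - L) + 1 * (\<Sum>k\<in>L. X k \<omega>))
      = normal_measure (sum m (K - L) + 1 * sum m L) (1\<^sup>2 * sum v L)"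
    using X L v by (intro distr_normal_affine) (auto intro!: borel_measurable_sum sum_nonneg)
  then show ?thesis
    using X L by (subst distr_cong_AE[OF refl refl ae])
      (auto simp: sum_v split[of m] intro!: borel_measurable_sum borel_measurable_add)
qed

text \<open>Integrability is recorded along with the values because the integral of a non-integrable
  function is \<open>0\<close> by convention. The degenerate case is that of an almost sure
  constant.\<close>

lemma normal_measure_moments:
  assumes X: "X \<in> borel_measurable M" and law: "distr M borel X = normal_measure m v" and "v \<ge> 0"
  shows "integrable M X" and "expectation X = m"
    and "integrable M (\<lambda>\<omega>. (X \<omega> - m)\<^sup>2)" and "expectation (\<lambda>\<omega>. (X \<omega> - m)\<^sup>2) = v"
proof -
  have "integrable M X \<and> expectation X = m \<and> integrable M (\<lambda>\<omega>. (X \<omega> - m)\<^sup>2) \<and>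
    expectation (\<lambda>\<omega>. (X \<omega> - m)\<^sup>2) = v"
  proof (cases "v = 0")
    case True
    then have ae: "AE \<omega> in M. X \<omega> = m"
      using law by (simp flip: distr_eq_normal_measure_0_iff[OF X])
    then have ae2: "AE \<omega> in M. (X \<omega> - m)\<^sup>2 = 0" by eventually_elim simp
    have "integrable M X \<longleftrightarrow> integrable M (\<lambda>_. m)" "expectation X = expectation (\<lambda>_. m)"
      using ae X by (intro integrable_cong_AE integral_cong_AE; simp)+
    moreover have "integrable M (\<lambda>\<omega>. (X \<omega> - m)\<^sup>2) \<longleftrightarrow> integrable M (\<lambda>_. 0::real)"
      "expectation (\<lambda>\<omega>. (X \<omega> - m)\<^sup>2) = expectation (\<lambda>_. 0)"
      using ae2 X by (intro integrable_cong_AE integral_cong_AE; simp)+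
    ultimately show ?thesis using True by (simp add: prob_space)
  next
    case False
    then have "sqrt v > 0" using \<open>v \<ge> 0\<close> by simp
    have D: "distributed M lborel X (normal_density m (sqrt v))"
      using law X False by (simp add: distr_eq_normal_measure_iff)
    have E: "expectation X = m" by (rule normal_distributed_expectation[OF \<open>sqrt v > 0\<close> D])
    have "integrable M X"
      using integrable_normal_moment_nz_1[OF \<open>sqrt v > 0\<close>] distributed_integrable[OF D, of "\<lambda>x. x"]
      by simp
    moreover have "integrable M (\<lambda>\<omega>. (X \<omega> - m)\<^sup>2)"
      using integrable_normal_moment[OF \<open>sqrt v > 0\<close>, of m 2]
        distributed_integrable[OF D, of "\<lambda>x. (x - m)\<^sup>2"] by simp
    moreover have "expectation (\<lambda>\<omega>. (X \<omega> - m)\<^sup>2) = v"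
      using normal_distributed_variance[OF \<open>sqrt v > 0\<close> D] \<open>v \<ge> 0\<close> unfolding E by simp
    ultimately show ?thesis using E by simp
  qed
  then show "integrable M X" "expectation X = m"
    "integrable M (\<lambda>\<omega>. (X \<omega> - m)\<^sup>2)" "expectation (\<lambda>\<omega>. (X \<omega> - m)\<^sup>2) = v" by auto
qed

text \<open>Jensen's inequality for the square, that is, nonnegativity of the variance.\<close>

lemma square_expectation_le:
  fixes Y :: "'a \<Rightarrow> real"
  assumes "integrable M Y" "integrable M (\<lambda>\<omega>. (Y \<omega>)\<^sup>2)"
  shows "(expectation Y)\<^sup>2 \<le> expectation (\<lambda>\<omega>. (Y \<omega>)\<^sup>2)"
  using variance_eq[OF assms] variance_positive[of Y] by simp

section \<open>Gaussian vectors\<close>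

text \<open>Since \<open>gaussian\<close> is defined through linear functionals, it suffices to
  project onto each \<open>u\<close>. The projections of independent vectors are independent scalar
  normals, whose means and variances add.\<close>

lemma gaussian_linear_combination:
  fixes X :: "'k \<Rightarrow> 'a \<Rightarrow> real ^ 'd"
  assumes "finite K" and indep: "indep_vars (\<lambda>_. borel) X K"
    and X: "\<And>k. k \<in> K \<Longrightarrow> gaussian M (X k) (m k) (S k)"
  shows "gaussian M (\<lambda>\<omega>. q + (\<Sum>k\<in>K. c k *\<^sub>R X k \<omega>)) (q + (\<Sum>k\<in>K. c k *\<^sub>R m k))
    (\<Sum>k\<in>K. (c k)\<^sup>2 *\<^sub>R S k)"
proof -
  have meas: "X k \<in> borel_measurable M" if "k \<in> K" for k
    using X[OF that] by (simp add: gaussian_def)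
  have quad: "u \<bullet> ((\<Sum>k\<in>K. (c k)\<^sup>2 *\<^sub>R S k) *v u) = (\<Sum>k\<in>K. (c k)\<^sup>2 * (u \<bullet> (S k *v u)))" for u
    using \<open>finite K\<close>
    by induction (simp_all add: matrix_vector_mult_add_rdistrib inner_add_right
        flip: scaleR_matrix_vector_assoc)
  have "distr M borel (\<lambda>\<omega>. u \<bullet> (q + (\<Sum>k\<in>K. c k *\<^sub>R X k \<omega>)))
      = normal_measure (u \<bullet> (q + (\<Sum>k\<in>K. c k *\<^sub>R m k)))
          (u \<bullet> ((\<Sum>k\<in>K. (c k)\<^sup>2 *\<^sub>R S k) *v u))" for u
  proof -
    \<comment> \<open>The summand \<open>0\<close> matches the form \<open>q + c * X\<close> of
      \<open>distr_normal_affine\<close>; the actual shift \<open>u \<bullet> q\<close> is added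
      after summation.\<close>
    let ?Y = "\<lambda>k \<omega>. 0 + c k * (u \<bullet> X k \<omega>)"
    have law: "distr M borel (?Y k) = normal_measure (0 + c k * (u \<bullet> m k)) ((c k)\<^sup>2 * (u \<bullet> (S k *v u)))"
      if "k \<in> K" for k
      using X[OF that] meas[OF that]
      by (intro distr_normal_affine) (auto simp: gaussian_def)
    have nonneg: "u \<bullet> (S k *v u) \<ge> 0" if "k \<in> K" for k
      using X[OF that] by (simp add: gaussian_def)
    have "indep_vars (\<lambda>_. borel) ?Y K"
      using indep by (rule indep_vars_compose2) measurable
    then have "distr M borel (\<lambda>\<omega>. \<Sum>k\<in>K. ?Y k \<omega>) = normal_measure
        (\<Sum>k\<in>K. 0 + c k * (u \<bullet> m k)) (\<Sum>k\<in>K. (c k)\<^sup>2 * (u \<bullet> (S k *v u)))"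
      using \<open>finite K\<close> law nonneg by (intro distr_sum_indep_normal) auto
    then have "distr M borel (\<lambda>\<omega>. u \<bullet> q + 1 * (\<Sum>k\<in>K. ?Y k \<omega>)) = normal_measure
        (u \<bullet> q + 1 * (\<Sum>k\<in>K. 0 + c k * (u \<bullet> m k)))
        (1\<^sup>2 * (\<Sum>k\<in>K. (c k)\<^sup>2 * (u \<bullet> (S k *v u))))"
      using meas nonneg by (intro distr_normal_affine) (auto intro!: borel_measurable_sum sum_nonneg)
    then show ?thesis by (simp add: quad inner_add_right inner_sum_right)
  qed
  moreover have "transpose (\<Sum>k\<in>K. (c k)\<^sup>2 *\<^sub>R S k) = (\<Sum>k\<in>K. (c k)\<^sup>2 *\<^sub>R S k)"
    using X by (auto simp: gaussian_def transpose_def vec_eq_iff intro!: sum.cong)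
  moreover have "u \<bullet> ((\<Sum>k\<in>K. (c k)\<^sup>2 *\<^sub>R S k) *v u) \<ge> 0" for u
    using X unfolding quad by (auto simp: gaussian_def intro!: sum_nonneg)
  ultimately show ?thesis
    unfolding gaussian_def using meas by (auto intro!: borel_measurable_sum borel_measurable_add)
qed

text \<open>The lower bound tests \<open>X\<close> against its own mean by Cauchy-Schwarz. The upper
  bound combines the triangle inequality with Jensen's inequality for the centred norm, whose second
  moment is the trace of \<open>C\<close>.\<close>

lemma gaussian_integrable_norm:
  fixes X :: "'a \<Rightarrow> real ^ 'd"
  assumes "gaussian M X \<mu> C"
  shows "integrable M (\<lambda>\<omega>. norm (X \<omega>))"
    and "norm \<mu> \<le> expectation (\<lambda>\<omega>. norm (X \<omega>))"
    and "expectation (\<lambda>\<omega>. norm (X \<omega>)) \<le> norm \<mu> + sqrt (trace C)"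
proof -
  have X: "X \<in> borel_measurable M" using assms by (simp add: gaussian_def)
  have moments: "integrable M (\<lambda>\<omega>. u \<bullet> X \<omega>)" "expectation (\<lambda>\<omega>. u \<bullet> X \<omega>) = u \<bullet> \<mu>"
    "integrable M (\<lambda>\<omega>. (u \<bullet> X \<omega> - u \<bullet> \<mu>)\<^sup>2)"
    "expectation (\<lambda>\<omega>. (u \<bullet> X \<omega> - u \<bullet> \<mu>)\<^sup>2) = u \<bullet> (C *v u)" for u
    using normal_measure_moments[of "\<lambda>\<omega>. u \<bullet> X \<omega>" "u \<bullet> \<mu>" "u \<bullet> (C *v u)"] X assms
    by (auto simp: gaussian_def)
  \<comment> \<open>The functional \<open>axis i 1\<close> extracts a coordinate, and its quadratic
    form is a diagonal entry of \<open>C\<close>.\<close>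
  have comp: "integrable M (\<lambda>\<omega>. X \<omega> $ i)" for i
    using moments(1)[of "axis i 1"] by (simp add: inner_axis')
  have sq: "integrable M (\<lambda>\<omega>. (X \<omega> $ i - \<mu> $ i)\<^sup>2)"
    "expectation (\<lambda>\<omega>. (X \<omega> $ i - \<mu> $ i)\<^sup>2) = C $ i $ i" for i
    using moments(3,4)[of "axis i 1"]
    by (simp_all add: inner_axis' matrix_vector_mult_basis column_def)
  show int: "integrable M (\<lambda>\<omega>. norm (X \<omega>))"
  proof (rule Bochner_Integration.integrable_bound)
    show "integrable M (\<lambda>\<omega>. \<Sum>i\<in>UNIV. \<bar>X \<omega> $ i\<bar>)"
      using comp by (intro Bochner_Integration.integrable_sum integrable_abs)
    show "AE \<omega> in M. norm (norm (X \<omega>)) \<le> norm (\<Sum>i\<in>UNIV. \<bar>X \<omega> $ i\<bar>)"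
      by (auto intro!: AE_I2 order_trans[OF norm_le_l1_cart])
  qed (use X in measurable)
  have "norm \<mu> * norm \<mu> = expectation (\<lambda>\<omega>. \<mu> \<bullet> X \<omega>)"
    unfolding moments by (simp add: norm_eq_sqrt_inner)
  also have "\<dots> \<le> expectation (\<lambda>\<omega>. norm \<mu> * norm (X \<omega>))"
    using int moments(1) by (intro integral_mono) (auto simp: norm_cauchy_schwarz)
  finally have "norm \<mu> * norm \<mu> \<le> norm \<mu> * expectation (\<lambda>\<omega>. norm (X \<omega>))" by simp
  then show "norm \<mu> \<le> expectation (\<lambda>\<omega>. norm (X \<omega>))"
    \<comment> \<open>Cancelling \<open>norm \<mu>\<close> requires \<open>\<mu>\<close> nonzero;
      otherwise the claim is nonnegativity of the integral.\<close>
    by (cases "\<mu> = 0") (auto intro!: Bochner_Integration.integral_nonneg)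
  let ?Y = "\<lambda>\<omega>. norm (X \<omega> - \<mu>)"
  have Y_sq: "(?Y \<omega>)\<^sup>2 = (\<Sum>i\<in>UNIV. (X \<omega> $ i - \<mu> $ i)\<^sup>2)" for \<omega>
    by (simp add: norm_vec_def L2_set_def sum_nonneg)
  have int_Y: "integrable M ?Y"
  proof (rule Bochner_Integration.integrable_bound)
    show "integrable M (\<lambda>\<omega>. norm (X \<omega>) + norm \<mu>)" using int by simp
    show "AE \<omega> in M. norm (?Y \<omega>) \<le> norm (norm (X \<omega>) + norm \<mu>)"
      by (intro AE_I2) (simp add: norm_triangle_ineq4)
  qed (use X in measurable)
  have "(expectation ?Y)\<^sup>2 \<le> expectation (\<lambda>\<omega>. (?Y \<omega>)\<^sup>2)"
    using int_Y sq by (intro square_expectation_le) (simp_all add: Y_sq)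
  also have "\<dots> = trace C" using sq by (simp add: Y_sq trace_def)
  finally have "expectation ?Y \<le> sqrt (trace C)" by (rule real_le_rsqrt)
  moreover have "expectation (\<lambda>\<omega>. norm (X \<omega>)) \<le> expectation (\<lambda>\<omega>. norm \<mu> + ?Y \<omega>)"
    using int int_Y norm_triangle_sub by (intro integral_mono) auto
  ultimately show "expectation (\<lambda>\<omega>. norm (X \<omega>)) \<le> norm \<mu> + sqrt (trace C)"
    using int_Y by (simp add: prob_space)
qed

end

theorem proposition4p1:
  fixes r J :: nat and h \<sigma> M \<tau> \<kappa> b R \<alpha> \<beta> :: real
    and w c :: "int \<Rightarrow> real"
    and a p e :: "real ^ 'd"
    and s :: "real ^ 'd \<Rightarrow> real"
    and fp fm :: "real ^ 'd \<Rightarrow> real \<Rightarrow> real ^ 'd"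
    and xref xp xm x1 x2 :: "real \<Rightarrow> real ^ 'd"
    and I W :: "real set"
    and P :: "'w measure" and T :: "'i set" and n :: 'i
    and \<eta> :: "'i \<Rightarrow> int \<Rightarrow> 'w \<Rightarrow> real ^ 'd"
    and t0 :: "'i \<Rightarrow> real" and t :: "int \<Rightarrow> real" and j :: int
    and \<Delta>1 \<Delta>2 :: "'w \<Rightarrow> real ^ 'd"
    and C :: "real ^ 'd ^ 'd"
  assumes h: "h > 0" and \<sigma>: "\<sigma> \<ge> 0"
    and w_sum: "(\<Sum>k\<in>{- int r..int r}. w k) = 0"
    and w_moment: "(\<Sum>k\<in>{- int r..int r}. w k * (of_int k * h)) = 1"
    and noise: "noise_model P T J \<sigma> \<eta>"
    and n: "n \<in> T"
    and t: "t = sample_time (t0 n) h"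
    and stencil: "{j - int r..j + int r + 1} \<subseteq> {0..int J}"
    and W: "W = {t (j - int r)..t (j + int r + 1)}"
    and s: "s = (\<lambda>x. a \<bullet> x + b)" and a: "a \<noteq> 0"
    and fp: "smooth (\<lambda>(x, u). fp x u)" and fm: "smooth (\<lambda>(x, u). fm x u)"
    and I: "is_interval I" "W \<subseteq> I"
    and xref: "piecewise_solution_on s fp fm I xref"
    and crossing: "\<tau> \<in> interior I" "\<forall>u\<in>I. s (xref u) = 0 \<longleftrightarrow> u = \<tau>"
      "\<forall>u\<in>I. u < \<tau> \<longrightarrow> s (xref u) < 0"
    and p: "p = xref \<tau>"
    and transversal: "transversal a fp fm p \<tau>"
    and in_stencil: "\<tau> \<in> W"
    and xp: "solution_on fp W xp" "xp \<tau> = p"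
    and xm: "solution_on fm W xm" "\<forall>u\<in>W. u \<le> \<tau> \<longrightarrow> xm u = xref u"
    and jump: "fp p \<tau> - fm p \<tau> = \<kappa> *\<^sub>R e" "\<kappa> = norm (fp p \<tau> - fm p \<tau>)" "\<kappa> > 0" "norm e = 1"
    and xp_bound: "\<forall>u\<in>W. norm (vector_derivative
        (\<lambda>v. vector_derivative xp (at v within W)) (at u within W)) \<le> M"
    and xm_bound: "\<forall>u\<in>W. norm (vector_derivative
        (\<lambda>v. vector_derivative xm (at v within W)) (at u within W)) \<le> M"
    and c: "c = jump_coeff w r"
    and R: "R = (\<Sum>k\<in>{- int r..int r + 1}. c k * max (t (j + k) - \<tau>) 0)"
    and \<alpha>: "\<alpha> = M * (\<Sum>k\<in>{k \<in> {- int r..int r + 1}. t (j + k) > \<tau>}. \<bar>c k\<bar> * (t (j + k) - \<tau>)\<^sup>2)"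
    and \<beta>: "\<beta> = M / 2 * (\<Sum>k\<in>{- int r..int r + 1}. \<bar>c k\<bar> * (t (j + k) - t j)\<^sup>2)"
    and C: "C = (\<sigma>\<^sup>2 * (L2_set c {- int r..int r + 1})\<^sup>2) *\<^sub>R mat 1"
    and x1: "\<forall>u\<in>W. x1 u = (if u \<le> \<tau> then xm u else xp u)"
    and x2: "\<forall>u\<in>W. x2 u = xm u"
    and \<Delta>1: "\<Delta>1 = (\<lambda>\<omega>. jump_est w r (observation x1 t (\<eta> n) \<omega>) j)"
    and \<Delta>2: "\<Delta>2 = (\<lambda>\<omega>. jump_est w r (observation x2 t (\<eta> n) \<omega>) j)"
  shows "(\<exists>\<mu>1 \<mu>2 \<rho>.
            gaussian P \<Delta>1 \<mu>1 C \<and> gaussian P \<Delta>2 \<mu>2 C \<and>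
            \<mu>1 - \<mu>2 = (\<kappa> * R) *\<^sub>R e + \<rho> \<and> norm \<rho> \<le> \<alpha>)
       \<and> integrable P (\<lambda>\<omega>. norm (\<Delta>1 \<omega>)) \<and> integrable P (\<lambda>\<omega>. norm (\<Delta>2 \<omega>))
       \<and> (\<integral>\<omega>. norm (\<Delta>1 \<omega>) \<partial>P) \<ge> \<kappa> * \<bar>R\<bar> - \<beta> - \<alpha>
       \<and> (\<integral>\<omega>. norm (\<Delta>2 \<omega>) \<partial>P)
           \<le> \<beta> + \<sigma> * L2_set c {- int r..int r + 1} * sqrt (real CARD('d))
       \<and> (\<kappa> * \<bar>R\<bar> > 2 * \<beta> + \<alpha> + \<sigma> * L2_set c {- int r..int r + 1} * sqrt (real CARD('d))
           \<longrightarrow> (\<integral>\<omega>. norm (\<Delta>1 \<omega>) \<partial>P) > (\<integral>\<omega>. norm (\<Delta>2 \<omega>) \<partial>P))"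
proof -
  let ?K = "{- int r..int r + 1}"
  define A B where "A = t (j - int r)" and "B = t (j + int r + 1)"
  have WAB: "W = {A..B}" by (simp add: W A_def B_def)
  have AB: "A < B" using h by (simp add: A_def B_def t sample_time_def)
  have t_diff: "t (j + k) - t j = of_int k * h" for k
    by (simp add: t sample_time_def algebra_simps)
  have tW: "t (j + k) \<in> {A..B}" if "k \<in> ?K" for k
  proof -
    have "of_int l * h \<le> of_int l' * h" if "l \<le> l'" for l l'
      using that h by (intro mult_right_mono) auto
    from this[of "j - int r" "j + k"] this[of "j + k" "j + int r + 1"] that
    show ?thesis by (simp add: A_def B_def t sample_time_def)
  qed
  have tjW: "t j \<in> {A..B}" using tW[of 0] by simp
  have \<tau>W: "\<tau> \<in> {A..B}" using in_stencil WAB by simp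
  \<comment> \<open>The agreement of \<open>xm\<close> with \<open>xref\<close> includes the time
    \<open>\<tau>\<close> itself, so both smooth branches pass through \<open>p\<close>.\<close>
  have xm_\<tau>: "xm \<tau> = p" using xm(2) in_stencil p by auto

  \<comment> \<open>Zeroth and first moments of the jump coefficients\<close>
  have c_sum: "(\<Sum>k\<in>?K. c k) = 0"
    \<comment> \<open>Both moments are read off from test sequences. A constant sequence has equal
      velocity estimates at neighbouring indices; for the identity sequence the two estimates differ
      by the sum of the weights, which is zero.\<close>
    using jump_est_eq_sum[of w r "\<lambda>_. 1::real" j] by (simp add: c jump_est_def velocity_est_def)
  have c_moment: "(\<Sum>k\<in>?K. c k * of_int k) = 0"
    using jump_est_eq_sum[of w r "\<lambda>l. of_int l :: real" 0] w_sum
    by (simp add: c jump_est_def velocity_est_def algebra_simps sum.distrib)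

  define xp'' where "xp'' u = vector_derivative (\<lambda>v. vector_derivative xp (at v within W)) (at u within W)" for u
  define xm'' where "xm'' u = vector_derivative (\<lambda>v. vector_derivative xm (at v within W)) (at u within W)" for u
  have xp': "(xp has_vector_derivative fp (xp u) u) (at u within {A..B})"
    and xm': "(xm has_vector_derivative fm (xm u) u) (at u within {A..B})" if "u \<in> {A..B}" for u
    using xp(1) xm(1) that by (simp_all add: solution_on_def WAB)
  have xp'': "((\<lambda>v. fp (xp v) v) has_vector_derivative xp'' u) (at u within {A..B})"
    and xm'': "((\<lambda>v. fm (xm v) v) has_vector_derivative xm'' u) (at u within {A..B})"
    if "u \<in> {A..B}" for u
    unfolding xp''_def xm''_def WAB
    using solution_on_derivative_differentiable[OF fp _ AB that, of xp]
      solution_on_derivative_differentiable[OF fm _ AB that, of xm] xp(1) xm(1)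
    by (simp_all add: WAB)
  have M: "norm (xp'' u) \<le> M" "norm (xm'' u) \<le> M" if "u \<in> {A..B}" for u
    using xp_bound xm_bound that by (simp_all add: xp''_def xm''_def WAB)

  define \<mu>1 where "\<mu>1 = (\<Sum>k\<in>?K. c k *\<^sub>R x1 (t (j + k)))"
  define \<mu>2 where "\<mu>2 = (\<Sum>k\<in>?K. c k *\<^sub>R x2 (t (j + k)))"
  \<comment> \<open>With this choice the formula for the difference of the means holds by
    definition, and only the bound on \<open>\<rho>\<close> remains.\<close>
  define \<rho> where "\<rho> = \<mu>1 - \<mu>2 - (\<kappa> * R) *\<^sub>R e"

  \<comment> \<open>Bound on the mean without a switch\<close>
  define rem where "rem k = xm (t (j + k)) - xm (t j) - (t (j + k) - t j) *\<^sub>R fm (xm (t j)) (t j)" for k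
  have rem: "norm (rem k) \<le> M / 2 * (t (j + k) - t j)\<^sup>2" if "k \<in> ?K" for k
    unfolding rem_def using xm' xm'' M(2) tjW tW[OF that] by (intro norm_taylor2_le[of A B xm]) auto
  have "\<mu>2 = (\<Sum>k\<in>?K. c k *\<^sub>R rem k + (c k *\<^sub>R xm (t j) + (c k * of_int k * h) *\<^sub>R fm (xm (t j)) (t j)))"
    unfolding \<mu>2_def rem_def t_diff using x2 tW
    by (intro sum.cong) (auto simp: WAB scaleR_add_right scaleR_diff_right mult_ac)
  \<comment> \<open>The constant and linear parts of the expansion about \<open>t j\<close> vanish
    by \<open>c_sum\<close> and \<open>c_moment\<close>.\<close>
  also have "\<dots> = (\<Sum>k\<in>?K. c k *\<^sub>R rem k)"
    by (simp add: sum.distrib c_sum c_moment flip: scaleR_sum_left sum_distrib_right)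
  finally have \<mu>2_rem: "\<mu>2 = (\<Sum>k\<in>?K. c k *\<^sub>R rem k)" .
  have "norm \<mu>2 \<le> (\<Sum>k\<in>?K. \<bar>c k\<bar> * (M / 2 * (t (j + k) - t j)\<^sup>2))"
    unfolding \<mu>2_rem
    by (rule sum_norm_le) (unfold norm_scaleR, intro mult_left_mono rem abs_ge_zero)
  also have "\<dots> = \<beta>" by (simp add: \<beta> sum_distrib_left mult_ac)
  finally have \<mu>2: "norm \<mu>2 \<le> \<beta>" .

  \<comment> \<open>Difference of the two means\<close>
  define L where "L = {k \<in> ?K. t (j + k) > \<tau>}"
  define gap where "gap k = xp (t (j + k)) - xm (t (j + k)) - (t (j + k) - \<tau>) *\<^sub>R \<kappa> *\<^sub>R e" for k
  have gap: "norm (gap k) \<le> M * (t (j + k) - \<tau>)\<^sup>2" if "k \<in> L" for k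
  proof -
    let ?v = "t (j + k)"
    \<comment> \<open>The difference \<open>xp - xm\<close> has second derivative at most
      \<open>2 * M\<close>, and the Taylor factor one half leaves the constant \<open>M\<close> of
      \<open>\<alpha>\<close>. At \<open>\<tau>\<close> the difference vanishes and its velocity is
      the jump of the vector field.\<close>
    have "norm ((xp ?v - xm ?v) - (xp \<tau> - xm \<tau>) - (?v - \<tau>) *\<^sub>R (fp (xp \<tau>) \<tau> - fm (xm \<tau>) \<tau>))
        \<le> 2 * M / 2 * (?v - \<tau>)\<^sup>2"
    proof (rule norm_taylor2_le[where x' = "\<lambda>u. fp (xp u) u - fm (xm u) u" and x'' = "\<lambda>u. xp'' u - xm'' u"])
      show "norm (xp'' u - xm'' u) \<le> 2 * M" if "u \<in> {A..B}" for u
        using M[OF that] norm_triangle_ineq4[of "xp'' u" "xm'' u"] by linarith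
    qed (use xp' xm' xp'' xm'' \<tau>W tW that in \<open>auto simp: L_def intro!: has_vector_derivative_diff\<close>)
    then show ?thesis by (simp add: gap_def xm_\<tau> xp(2) jump(1))
  qed
  have R_L: "R = (\<Sum>k\<in>L. c k * (t (j + k) - \<tau>))"
    unfolding R L_def by (rule sum.mono_neutral_cong_right) auto
  \<comment> \<open>At sample times up to and including \<open>\<tau>\<close> both scenarios follow
    \<open>xm\<close>, so only the offsets in \<open>L\<close> contribute.\<close>
  have "\<mu>1 - \<mu>2 = (\<Sum>k\<in>L. c k *\<^sub>R (xp (t (j + k)) - xm (t (j + k))))"
    unfolding \<mu>1_def \<mu>2_def L_def sum_subtractf[symmetric]
    by (rule sum.mono_neutral_cong_right) (use x1 x2 tW in \<open>auto simp: WAB algebra_simps\<close>)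
  then have \<rho>_gap: "\<rho> = (\<Sum>k\<in>L. c k *\<^sub>R gap k)"
    by (simp add: \<rho>_def R_L gap_def sum_distrib_left scaleR_sum_left sum_subtractf
        scaleR_diff_right mult_ac)
  have "norm \<rho> \<le> (\<Sum>k\<in>L. \<bar>c k\<bar> * (M * (t (j + k) - \<tau>)\<^sup>2))"
    unfolding \<rho>_gap
    by (rule sum_norm_le) (unfold norm_scaleR, intro mult_left_mono gap abs_ge_zero)
  also have "\<dots> = \<alpha>" by (simp add: \<alpha> L_def sum_distrib_left mult_ac)
  finally have \<rho>: "norm \<rho> \<le> \<alpha>" .

  \<comment> \<open>Common noise and law of the estimates\<close>
  interpret prob_space P using noise by (simp add: noise_model_def)
  \<comment> \<open>Independence is assumed over pairs of trajectory and sample, so the stencil is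
    embedded as pairs; an offset is recovered from \<open>z\<close> as
    \<open>snd z - j\<close>.\<close>
  let ?S = "(\<lambda>k. (n, j + k)) ` ?K"
  have inj: "inj_on (\<lambda>k. (n, j + k)) ?K" by (auto intro: inj_onI)
  have index: "?S \<subseteq> T \<times> {0..int J}" using stencil n by (auto simp: subset_iff)
  have law: "gaussian P (\<lambda>\<omega>. q + (\<Sum>k\<in>?K. c k *\<^sub>R \<eta> n (j + k) \<omega>)) q C" for q
  proof -
    have "gaussian P (\<lambda>\<omega>. q + (\<Sum>z\<in>?S. c (snd z - j) *\<^sub>R (case z of (i, l) \<Rightarrow> \<eta> i l) \<omega>))
        (q + (\<Sum>z\<in>?S. c (snd z - j) *\<^sub>R 0)) (\<Sum>z\<in>?S. (c (snd z - j))\<^sup>2 *\<^sub>R \<sigma>\<^sup>2 *\<^sub>R mat 1)"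
    proof (rule gaussian_linear_combination)
      show "indep_vars (\<lambda>_. borel) (\<lambda>(i, l). \<eta> i l) ?S"
        using noise index unfolding noise_model_def by (blast intro: indep_vars_subset)
      show "gaussian P (case z of (i, l) \<Rightarrow> \<eta> i l) 0 (\<sigma>\<^sup>2 *\<^sub>R mat 1)" if "z \<in> ?S" for z
        using noise index that unfolding noise_model_def by fastforce
    qed simp
    moreover have "(\<Sum>z\<in>?S. (c (snd z - j))\<^sup>2 *\<^sub>R \<sigma>\<^sup>2 *\<^sub>R mat 1) = C"
      by (simp add: sum.reindex[OF inj] C L2_set_def sum_nonneg sum_distrib_left
          mult.commute flip: scaleR_sum_left)
    ultimately show ?thesis by (simp add: sum.reindex[OF inj] o_def)
  qed
  have \<Delta>1_eq: "\<Delta>1 = (\<lambda>\<omega>. \<mu>1 + (\<Sum>k\<in>?K. c k *\<^sub>R \<eta> n (j + k) \<omega>))"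
    by (simp add: \<Delta>1 jump_est_eq_sum observation_def \<mu>1_def c scaleR_add_right sum.distrib)
  have \<Delta>2_eq: "\<Delta>2 = (\<lambda>\<omega>. \<mu>2 + (\<Sum>k\<in>?K. c k *\<^sub>R \<eta> n (j + k) \<omega>))"
    by (simp add: \<Delta>2 jump_est_eq_sum observation_def \<mu>2_def c scaleR_add_right sum.distrib)
  have g: "gaussian P \<Delta>1 \<mu>1 C" "gaussian P \<Delta>2 \<mu>2 C"
    unfolding \<Delta>1_eq \<Delta>2_eq by (rule law)+

  \<comment> \<open>Expected magnitudes\<close>
  have "trace C = \<sigma>\<^sup>2 * (L2_set c ?K)\<^sup>2 * real CARD('d)"
    by (simp add: C trace_def mat_def)
  then have sqrt_trace: "sqrt (trace C) = \<sigma> * L2_set c ?K * sqrt (real CARD('d))"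
    using \<sigma> by (simp add: real_sqrt_mult L2_set_nonneg)
  have eq: "\<mu>1 - \<mu>2 = (\<kappa> * R) *\<^sub>R e + \<rho>" by (simp add: \<rho>_def)
  \<comment> \<open>As \<open>e\<close> is a unit vector and \<open>\<kappa>\<close> is positive,
    the triangle inequality bounds \<open>norm \<mu>1\<close> from below; the mean norm of
    \<open>\<Delta>1\<close> is at least that.\<close>
  have "\<kappa> * \<bar>R\<bar> = norm (\<mu>1 - \<mu>2 - \<rho>)"
    using jump(3,4) by (simp add: eq abs_mult)
  also have "\<dots> \<le> norm \<mu>1 + norm \<mu>2 + norm \<rho>"
    using norm_triangle_ineq4[of "\<mu>1 - \<mu>2" \<rho>] norm_triangle_ineq4[of \<mu>1 \<mu>2] by linarith
  finally have lower: "\<kappa> * \<bar>R\<bar> - \<beta> - \<alpha> \<le> (\<integral>\<omega>. norm (\<Delta>1 \<omega>) \<partial>P)"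
    using \<mu>2 \<rho> gaussian_integrable_norm(2)[OF g(1)] by linarith
  have upper: "(\<integral>\<omega>. norm (\<Delta>2 \<omega>) \<partial>P) \<le> \<beta> + \<sigma> * L2_set c ?K * sqrt (real CARD('d))"
    using gaussian_integrable_norm(3)[OF g(2)] \<mu>2 unfolding sqrt_trace by linarith
  show ?thesis
    \<comment> \<open>The final implication holds because its premise places the lower bound for
      \<open>\<Delta>1\<close> strictly above the upper bound for \<open>\<Delta>2\<close>.\<close>
    using g eq \<rho> gaussian_integrable_norm(1)[OF g(1)] gaussian_integrable_norm(1)[OF g(2)] lower upper
    by (intro conjI impI exI[of _ \<mu>1] exI[of _ \<mu>2] exI[of _ \<rho>]) auto
qed

end
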